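(* Let $\alpha\in[-1,1]$, $\alpha\neq 0$. Then the lens map $\ell_\alpha:\mathbb{D}\to\mathbb{C}$ is a starlike mapping with order $$\beta=\frac{\alpha}{\sin\left(\frac{\pi}{2}\alpha\right)},$$ that is, $$\inf_{z\in\mathbb{D}}\operatorname{Re}\left\{z\,\frac{\ell_\alpha'(z)}{\ell_\alpha(z)}\right\}=\frac{\alpha}{\sin\left(\frac{\pi}{2}\alpha\right)}.$$
   Context: $\mathbb{D}=\{z\in\mathbb{C}:|z|<1\}$ is the open unit disc. For a real parameter $\alpha\neq 0$, the lens map is $$\ell_\alpha(z)=\frac{\left(\frac{1+z}{1-z}\right)^{\alpha}-1}{\left(\frac{1+z}{1-z}\right)^{\alpha}+1},\qquad z\in\mathbb{D},$$ where the power is taken with the principal branch (the Möbius map $z\mapsto (1+z)/(1-z)$ sends $\mathbb{D}$ onto the right half plane). A locally univalent holomorphic function $f$ on $\mathbb{D}$ with $f(0)=0$ and $f(z)\ne 0$ for $z\neq 0$ is starlike (with respect to the origin) when $\operatorname{Re}\{z f'(z)/f(z)\}>0$ on $\mathbb{D}$; its order of starlikeness is the exact value $\inf_{z\in\mathbb{D}}\operatorname{Re}\{z f'(z)/f(z)\}$. The quotient $zf'(z)/f(z)$ is understood at $z=0$ by its removable-singularity value $1$. These notions are applied to $\ell_\alpha$ without requiring the normalization $f'(0)=1$, since the quotient is unchanged when $f$ is multiplied by a nonzero constant. *)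

theory Defs
  imports "HOL-Complex_Analysis.Complex_Analysis"
begin

definition lens_map :: "real \<Rightarrow> complex \<Rightarrow> complex" where
  "lens_map \<alpha> z =
     (((1 + z) / (1 - z)) powr (of_real \<alpha>) - 1) / (((1 + z) / (1 - z)) powr (of_real \<alpha>) + 1)"

definition locally_univalent_on :: "(complex \<Rightarrow> complex) \<Rightarrow> complex set \<Rightarrow> bool" where
  "locally_univalent_on f S \<longleftrightarrow>
     f holomorphic_on S \<and> (\<forall>z\<in>S. \<exists>U. open U \<and> z \<in> U \<and> U \<subseteq> S \<and> inj_on f U)"

(* The value 1 at the origin is that of the removable singularity when f is holomorphic
   near 0 with a simple zero there. *)
definition starlike_quotient :: "(complex \<Rightarrow> complex) \<Rightarrow> complex \<Rightarrow> complex" where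
  "starlike_quotient f z = (if z = 0 then 1 else z * deriv f z / f z)"

(* No normalization of f'(0): the quotient is unchanged when f is multiplied by a nonzero
   constant. Not to be confused with the library's predicate starlike on sets. *)
definition starlike_map :: "(complex \<Rightarrow> complex) \<Rightarrow> bool" where
  "starlike_map f \<longleftrightarrow>
     locally_univalent_on f (ball 0 1) \<and>
     f 0 = 0 \<and> (\<forall>z\<in>ball 0 1. z \<noteq> 0 \<longrightarrow> f z \<noteq> 0) \<and>
     (\<forall>z\<in>ball 0 1. Re (starlike_quotient f z) > 0)"

(* A real infimum, hence meaningful only if the real parts are bounded below;
   for starlike f they are bounded below by 0. *)
definition starlikeness_order :: "(complex \<Rightarrow> complex) \<Rightarrow> real" where
  "starlikeness_order f = (INF z\<in>ball 0 1. Re (starlike_quotient f z))"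

end

theory Submission
  imports Defs
begin

text \<open>
  Put \<open>\<zeta> = Ln ((1 + z) / (1 - z))\<close>, which maps the disc onto the strip
  \<open>\<bar>Im \<zeta>\<bar> < \<pi>/2\<close>. Then \<open>z = tanh (\<zeta>/2)\<close> and \<open>\<ell>\<^sub>\<alpha>(z) = tanh (\<alpha>\<zeta>/2)\<close>, so the chain rule
  turns the starlike quotient into \<open>\<alpha> sinh \<zeta> / sinh (\<alpha>\<zeta>)\<close>
  (\<open>starlike_quotient_lens_map\<close>). This is even in \<open>\<alpha>\<close>, so only \<open>a = \<bar>\<alpha>\<bar>\<close> matters.

  With \<open>\<zeta> = x + iy\<close> and \<open>\<theta> = \<pi>a/2\<close>, the lower bound \<open>a / sin \<theta>\<close> for the real part says
  \<open>sinh\<^sup>2 ax + sin\<^sup>2 ay \<le> sin \<theta> (sinh x sinh ax cos y cos ay + cosh x cosh ax sin y sin ay)\<close>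
  (\<open>sinh_quotient_numerator_ge\<close>). By symmetry let \<open>x, y \<ge> 0\<close>. In \<open>x\<close> everything can be
  measured by \<open>S = sinh ax\<close>: \<open>sinh x \<ge> S/a\<close> and \<open>cosh x cosh ax \<ge> 1 + k S\<^sup>2\<close> with
  \<open>k = (1 + a\<^sup>2)/(2a\<^sup>2)\<close>, the constant that makes both sides agree to second order at
  \<open>x = 0\<close>. The inequality is then linear in \<open>S\<^sup>2\<close>, and it is enough to compare
  coefficients. The constant term needs \<open>sin ay \<le> sin y sin \<theta>\<close>; the coefficient of
  \<open>S\<^sup>2\<close> needs \<open>1 \<le> sin \<theta> (cos y cos ay / a + k sin y sin ay)\<close>. Both
  comparisons are sharpest at \<open>y = \<pi>/2\<close>, for one and the same reason: the derivatives
  in \<open>y\<close> of \<open>sin ay / sin y\<close> and of the bracket both have the sign dictated by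
  \<open>cos y sin ay \<le> a sin y cos ay\<close> (\<open>tan_scaling\<close>). At \<open>y = \<pi>/2\<close> the first is an equality and
  the second becomes \<open>sin\<^sup>2 \<theta> \<ge> 2a\<^sup>2/(1 + a\<^sup>2)\<close>, a one-variable inequality that follows from
  a cubic minorant of the sine.

  The bound is sharp: along \<open>\<zeta> = it\<close> the quotient is \<open>a sin t / sin at\<close>, which tends to
  \<open>a / sin \<theta>\<close> as \<open>t \<rightarrow> \<pi>/2\<close>.
\<close>

section \<open>A lower bound for the sine on a quarter period\<close>

lemma sin_ge_cubic:
  fixes x :: real
  assumes "0 \<le> x"
  shows "x - x ^ 3 / 6 \<le> sin x"
proof -
  have "\<bar>sin x - x\<bar> \<le> x ^ 3 / 6"
    using Maclaurin_sin_bound[of x 3] assms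
    by (simp add: numeral_3_eq_3 sin_coeff_def fact_numeral)
  then show ?thesis by linarith
qed

lemma cos_ge_quadratic:
  fixes x :: real
  shows "1 - x\<^sup>2 / 2 \<le> cos x"
proof -
  have "(sin (x / 2))\<^sup>2 \<le> (x / 2)\<^sup>2"
    by (rule abs_le_square_iff[THEN iffD1]) (rule abs_sin_x_le_abs_x)
  then show ?thesis
    using cos_double_sin[of "x / 2"] by (simp add: power_divide)
qed

text \<open>
  The comparison of Taylor polynomials of \<open>sin (\<pi>a/2)\<close> with a cubic that has rational
  coefficients, below, needs numerical bounds for \<open>\<pi>\<close>. They come from
  the exact values of cosine and sine at \<open>\<pi>/6\<close>, compared with their Taylor polynomials at \<open>0\<close>.
\<close>

lemma pi_gt_31_10: "31 / 10 < pi"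
proof -
  have "1 - (pi / 6)\<^sup>2 / 2 \<le> sqrt 3 / 2"
    using cos_ge_quadratic[of "pi / 6"] by (simp add: cos_30)
  moreover have "sqrt 3 < 1733 / 1000"
    by (rule real_less_lsqrt) (simp_all add: power2_eq_square)
  ultimately have "(31 / 10)\<^sup>2 < pi\<^sup>2"
    by (simp add: power_divide)
  then show ?thesis
    by (rule power_less_imp_less_base) simp
qed

lemma pi_lt_79_25: "pi < 79 / 25"
proof (rule ccontr)
  assume "\<not> pi < 79 / 25"
  then have "sin (79 / 150) \<le> sin (pi / 6)"
    using pi_gt_zero by (intro sin_monotone_2pi_le) simp_all
  moreover have "1 / 2 < 79 / 150 - (79 / 150 :: real) ^ 3 / 6"
    by (simp add: power3_eq_cube)
  ultimately show False
    using sin_ge_cubic[of "79 / 150"] by (simp add: sin_30)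
qed

text \<open>
  The odd cubic \<open>(3a - a\<^sup>3)/2\<close> has the same value and slope as \<open>sin (\<pi>a/2)\<close> at \<open>a = 1\<close>, and
  at \<open>a = 0\<close> its slope \<open>3/2\<close> is slightly below \<open>\<pi>/2\<close>. Hence Taylor polynomials suffice: the
  one at \<open>0\<close> lies above the cubic for \<open>a \<le> 1/2\<close>, the one at \<open>1\<close> for \<open>a \<ge> 1/2\<close>.
\<close>

lemma sin_half_pi_ge_cubic:
  fixes a :: real
  assumes "0 \<le> a" "a \<le> 1"
  shows "(3 * a - a ^ 3) / 2 \<le> sin (pi / 2 * a)"
proof (cases "a \<le> 1 / 2")
  case True
  have pi3: "pi ^ 3 \<le> (79 / 25) ^ 3"
    using pi_lt_79_25 by (intro power_mono) simp_all
  have pi3': "(31 / 10) ^ 3 \<le> pi ^ 3"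
    using pi_gt_31_10 by (intro power_mono) simp_all
  have "a\<^sup>2 \<le> (1 / 2)\<^sup>2"
    using True assms by (intro power_mono) simp_all
  then have "a\<^sup>2 * (pi ^ 3 / 48 - 1 / 2) \<le> (1 / 4) * (1 / 5)"
    using pi3 pi3' by (intro mult_mono) (simp_all add: power_divide)
  then have "0 \<le> a * (pi / 2 - 3 / 2 - a\<^sup>2 * (pi ^ 3 / 48 - 1 / 2))"
    using pi_gt_31_10 assms by (intro mult_nonneg_nonneg) simp_all
  also have "\<dots> = (pi / 2 * a) - (pi / 2 * a) ^ 3 / 6 - (3 * a - a ^ 3) / 2"
    by (simp add: power2_eq_square power3_eq_cube field_simps)
  finally show ?thesis
    using sin_ge_cubic[of "pi / 2 * a"] assms by simp
next
  case False
  define b where "b = 1 - a"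
  have b: "0 \<le> b" "b \<le> 1 / 2" and a: "a = 1 - b"
    using False assms by (simp_all add: b_def)
  have "pi\<^sup>2 \<le> (79 / 25)\<^sup>2"
    using pi_lt_79_25 by (intro power_mono) simp_all
  then have "0 \<le> b\<^sup>2 * (3 / 2 - pi\<^sup>2 / 8 - b / 2)"
    using b by (intro mult_nonneg_nonneg) (simp_all add: power_divide)
  also have "\<dots> = 1 - (pi / 2 * b)\<^sup>2 / 2 - (3 * a - a ^ 3) / 2"
    unfolding a by (simp add: power2_eq_square power3_eq_cube field_simps)
  finally have "(3 * a - a ^ 3) / 2 \<le> cos (pi / 2 * b)"
    using cos_ge_quadratic[of "pi / 2 * b"] by simp
  also have "cos (pi / 2 * b) = sin (pi / 2 * a)"
    unfolding a by (simp add: cos_sin_eq right_diff_distrib)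
  finally show ?thesis .
qed

lemma le_sin_half_pi:
  fixes a :: real
  assumes "0 \<le> a" "a \<le> 1"
  shows "a \<le> sin (pi / 2 * a)"
proof -
  have "a ^ 3 \<le> a"
    using assms power_decreasing[of 1 3 a] by simp
  then show ?thesis
    using sin_half_pi_ge_cubic[OF assms] by simp
qed

text \<open>
  After squaring the cubic minorant and setting \<open>c = a\<^sup>2\<close>, what remains is
  \<open>(1 + c)(3 - c)\<^sup>2 \<ge> 8\<close>, whose difference factors as \<open>(1 - c)(1 + 4c - c\<^sup>2)\<close>.
\<close>

lemma sin_half_pi_squared_ge:
  fixes a :: real
  assumes "0 \<le> a" "a \<le> 1"
  shows "2 * a\<^sup>2 \<le> (1 + a\<^sup>2) * (sin (pi / 2 * a))\<^sup>2"
proof -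
  define c where "c = a\<^sup>2"
  have c: "0 \<le> c" "c \<le> 1"
    using assms by (simp_all add: c_def power_le_one)
  have c2: "c\<^sup>2 \<le> c"
    using c by (simp add: power2_eq_square mult_left_le)
  have "0 \<le> (3 * a - a ^ 3) / 2"
  proof -
    have "a ^ 3 \<le> a"
      using assms power_decreasing[of 1 3 a] by simp
    then show ?thesis using assms by simp
  qed
  then have "((3 * a - a ^ 3) / 2)\<^sup>2 \<le> (sin (pi / 2 * a))\<^sup>2"
    by (rule power_mono[OF sin_half_pi_ge_cubic[OF assms]])
  then have "(1 + c) * ((3 * a - a ^ 3) / 2)\<^sup>2 \<le> (1 + c) * (sin (pi / 2 * a))\<^sup>2"
    using c by (intro mult_left_mono) simp_all
  moreover have "(1 + c) * ((3 * a - a ^ 3) / 2)\<^sup>2 - 2 * c = c * ((1 - c) * (1 + 4 * c - c\<^sup>2)) / 4"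
    unfolding c_def by (simp add: power2_eq_square power3_eq_cube field_simps)
  moreover have "0 \<le> c * ((1 - c) * (1 + 4 * c - c\<^sup>2)) / 4"
    using c c2 by (intro divide_nonneg_nonneg mult_nonneg_nonneg) simp_all
  ultimately show ?thesis
    unfolding c_def by linarith
qed

section \<open>Monotonicity in the imaginary direction\<close>

text \<open>
  This is \<open>tan (ay) \<le> a tan y\<close>, freed of denominators so that it includes \<open>y = \<pi>/2\<close>. The
  difference of the two sides vanishes at \<open>0\<close> and its derivative collapses to
  \<open>(1 - a\<^sup>2) sin y sin ay\<close>.
\<close>

lemma tan_scaling:
  fixes a y :: real
  assumes "0 < a" "a \<le> 1" "0 \<le> y" "y \<le> pi / 2"
  shows "cos y * sin (a * y) \<le> a * sin y * cos (a * y)"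
proof -
  let ?E = "\<lambda>t. a * sin t * cos (a * t) - cos t * sin (a * t)"
  have "?E 0 \<le> ?E y"
  proof (rule DERIV_nonneg_imp_nondecreasing[OF assms(3)])
    fix t assume t: "0 \<le> t" "t \<le> y"
    have at: "0 \<le> a * t" "a * t \<le> pi"
      using assms t mult_mono[of a 1 t pi] by (auto simp del: mult_1)
    have "(?E has_real_derivative (1 - a\<^sup>2) * (sin t * sin (a * t))) (at t)"
      by (auto intro!: derivative_eq_intros simp: power2_eq_square algebra_simps)
    moreover have "0 \<le> (1 - a\<^sup>2) * (sin t * sin (a * t))"
      using assms t at by (intro mult_nonneg_nonneg sin_ge_zero) (simp_all add: power_le_one)
    ultimately show "\<exists>d. (?E has_real_derivative d) (at t) \<and> 0 \<le> d" by blast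
  qed
  then show ?thesis by simp
qed

text \<open>
  By \<open>tan_scaling\<close> the quotient \<open>sin (ay) / sin y\<close> is nondecreasing on \<open>(0, \<pi>/2]\<close>, and \<open>sin (\<pi>a/2)\<close> is
  its value at the right endpoint.
\<close>

lemma sin_scaling_le:
  fixes a y :: real
  assumes "0 < a" "a \<le> 1" "0 \<le> y" "y \<le> pi / 2"
  shows "sin (a * y) \<le> sin y * sin (pi / 2 * a)"
proof (cases "y = 0")
  case False
  then have y: "0 < y" using assms by simp
  let ?q = "\<lambda>t. sin (a * t) / sin t"
  have "?q y \<le> ?q (pi / 2)"
  proof (rule DERIV_nonneg_imp_nondecreasing[OF assms(4)])
    fix t assume t: "y \<le> t" "t \<le> pi / 2"
    have s: "0 < sin t"
      using y t by (intro sin_gt_zero) simp_all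
    have "(?q has_real_derivative
        (a * sin t * cos (a * t) - cos t * sin (a * t)) / (sin t)\<^sup>2) (at t)"
      using s by (auto intro!: derivative_eq_intros simp: power2_eq_square field_simps)
    moreover have "0 \<le> (a * sin t * cos (a * t) - cos t * sin (a * t)) / (sin t)\<^sup>2"
      using tan_scaling[of a t] assms y t by simp
    ultimately show "\<exists>d. (?q has_real_derivative d) (at t) \<and> 0 \<le> d" by blast
  qed
  moreover have "0 < sin y"
    using y assms by (intro sin_gt_zero) simp_all
  ultimately show ?thesis
    by (simp add: field_simps)
qed simp

text \<open>
  The coefficients \<open>1/a\<close> and \<open>(1 + a\<^sup>2)/(2a\<^sup>2)\<close> are such that the derivative of the weighted
  sum is a nonnegative multiple of the left side minus the right side of \<open>tan_scaling\<close>. The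
  sum therefore decreases in \<open>y\<close>, and its value at \<open>\<pi>/2\<close> is controlled by \<open>sin_half_pi_squared_ge\<close>.
\<close>

lemma weighted_product_ge:
  fixes a y :: real
  assumes "0 < a" "a \<le> 1" "0 \<le> y" "y \<le> pi / 2"
  shows "1 \<le> sin (pi / 2 * a) *
    (cos y * cos (a * y) / a + (1 + a\<^sup>2) / (2 * a\<^sup>2) * (sin y * sin (a * y)))"
proof -
  let ?k = "(1 + a\<^sup>2) / (2 * a\<^sup>2)"
  let ?H = "\<lambda>t. cos t * cos (a * t) / a + ?k * (sin t * sin (a * t))"
  have s: "0 \<le> sin (pi / 2 * a)"
    using assms by (intro sin_ge_zero) simp_all
  have "?H (pi / 2) \<le> ?H y"
  proof (rule DERIV_nonpos_imp_nonincreasing[OF assms(4)])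
    fix t assume t: "y \<le> t" "t \<le> pi / 2"
    let ?d = "(1 - a\<^sup>2) / (2 * a\<^sup>2) * (cos t * sin (a * t) - a * sin t * cos (a * t))"
    have "(?H has_real_derivative ?d) (at t)"
      using assms by (auto intro!: derivative_eq_intros simp: power2_eq_square field_simps)
    moreover have "?d \<le> 0"
      using tan_scaling[of a t] assms t
      by (intro mult_nonneg_nonpos divide_nonneg_nonneg) (simp_all add: power_le_one)
    ultimately show "\<exists>d. (?H has_real_derivative d) (at t) \<and> d \<le> 0" by blast
  qed
  then have "sin (pi / 2 * a) * ?H (pi / 2) \<le> sin (pi / 2 * a) * ?H y"
    using s by (rule mult_left_mono)
  moreover have "1 \<le> sin (pi / 2 * a) * ?H (pi / 2)"
    using sin_half_pi_squared_ge[of a] assms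
    by (simp add: field_simps power2_eq_square)
  ultimately show ?thesis by linarith
qed

section \<open>Hyperbolic estimates in the real direction\<close>

lemma sinh_scaling_le:
  fixes a x :: real
  assumes "0 < a" "a \<le> 1" "0 \<le> x"
  shows "sinh (a * x) \<le> a * sinh x"
proof -
  let ?g = "\<lambda>t. a * sinh t - sinh (a * t)"
  have "?g 0 \<le> ?g x"
  proof (rule DERIV_nonneg_imp_nondecreasing[OF assms(3)])
    fix t assume t: "0 \<le> t" "t \<le> x"
    have "(?g has_real_derivative a * (cosh t - cosh (a * t))) (at t)"
      by (auto intro!: derivative_eq_intros simp: algebra_simps)
    moreover have "cosh (a * t) \<le> cosh t"
      using assms t by (subst cosh_real_nonneg_le_iff) (auto simp: mult_left_le_one_le)
    ultimately show "\<exists>d. (?g has_real_derivative d) (at t) \<and> 0 \<le> d"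
      using assms by (intro exI[of _ "a * (cosh t - cosh (a * t))"]) simp
  qed
  then show ?thesis by simp
qed

text \<open>
  Write \<open>C = cosh ax\<close>. Then \<open>cosh x cosh ax - 1 = C (cosh x - 1) + (C - 1)\<close>, and
  \<open>cosh x - 1 \<ge> (C - 1)/a\<^sup>2\<close> is \<open>sinh_scaling_le\<close> at the half argument, squared. The
  resulting lower bound \<open>(C - 1)(1 + C/a\<^sup>2)\<close> exceeds \<open>(1 + a\<^sup>2)/(2a\<^sup>2) (C\<^sup>2 - 1)\<close> by the
  nonnegative amount \<open>(1 - a\<^sup>2)/(2a\<^sup>2) (C - 1)\<^sup>2\<close>.
\<close>

lemma cosh_product_ge:
  fixes a x :: real
  assumes "0 < a" "a \<le> 1" "0 \<le> x"
  shows "(1 + a\<^sup>2) / (2 * a\<^sup>2) * (sinh (a * x))\<^sup>2 \<le> cosh x * cosh (a * x) - 1"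
proof -
  let ?C = "cosh (a * x)"
  have C: "1 \<le> ?C" by (rule cosh_real_ge_1)
  have half: "cosh t - 1 = 2 * (sinh (t / 2))\<^sup>2" for t :: real
    using cosh_double_cosh[of "t / 2"] by (simp add: cosh_square_eq)
  have "(sinh (a * (x / 2)))\<^sup>2 \<le> (a * sinh (x / 2))\<^sup>2"
    using assms by (intro power_mono sinh_scaling_le) simp_all
  then have "?C - 1 \<le> a\<^sup>2 * (cosh x - 1)"
    by (simp add: half power_mult_distrib)
  then have "(?C - 1) / a\<^sup>2 \<le> cosh x - 1"
    using assms by (simp add: field_simps)
  then have "?C * ((?C - 1) / a\<^sup>2) \<le> ?C * (cosh x - 1)"
    using C by (intro mult_left_mono) simp_all
  moreover have "(1 + a\<^sup>2) / (2 * a\<^sup>2) * (?C\<^sup>2 - 1)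
    = ?C * ((?C - 1) / a\<^sup>2) + (?C - 1) - (1 - a\<^sup>2) / (2 * a\<^sup>2) * (?C - 1)\<^sup>2"
    using assms by (simp add: power2_eq_square field_simps)
  moreover have "0 \<le> (1 - a\<^sup>2) / (2 * a\<^sup>2) * (?C - 1)\<^sup>2"
    using assms by (intro mult_nonneg_nonneg divide_nonneg_nonneg) (simp_all add: power_le_one)
  ultimately show ?thesis by (simp add: sinh_square_eq algebra_simps)
qed

section \<open>The real part of sinh z / sinh (a z) in the strip\<close>

text \<open>
  The two sides are the denominator of \<open>Re (sinh \<zeta> / sinh (a\<zeta>))\<close> and \<open>sin (\<pi>a/2)\<close> times its
  numerator, for \<open>\<zeta> = x + iy\<close>. Replacing \<open>sinh x\<close> and \<open>cosh x cosh ax\<close> by their lower bounds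
  leaves two polynomials of degree one in \<open>sinh\<^sup>2 ax\<close>, which are compared coefficientwise.
\<close>

lemma sinh_quotient_numerator_ge:
  fixes a x y :: real
  assumes a: "0 < a" "a \<le> 1" and y: "\<bar>y\<bar> \<le> pi / 2"
  shows "(sinh (a * x))\<^sup>2 + (sin (a * y))\<^sup>2 \<le> sin (pi / 2 * a) *
    (sinh x * sinh (a * x) * (cos y * cos (a * y)) +
     cosh x * cosh (a * x) * (sin y * sin (a * y)))"
proof -
  \<comment> \<open>All terms are even in both variables, so the first quadrant suffices.\<close>
  have *: "(sinh (a * x))\<^sup>2 + (sin (a * y))\<^sup>2 \<le> sin (pi / 2 * a) *
    (sinh x * sinh (a * x) * (cos y * cos (a * y)) +
     cosh x * cosh (a * x) * (sin y * sin (a * y)))"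
    if x: "0 \<le> x" and y: "0 \<le> y" "y \<le> pi / 2" for x y :: real
  proof -
    let ?S = "sinh (a * x)" and ?s = "sin (pi / 2 * a)" and ?k = "(1 + a\<^sup>2) / (2 * a\<^sup>2)"
    let ?p = "cos y * cos (a * y)" and ?q = "sin y * sin (a * y)"
    have ay: "0 \<le> a * y" "a * y \<le> pi / 2"
      using a y mult_mono[of a 1 y "pi / 2"] by (auto simp del: mult_1)
    have s: "0 \<le> ?s"
      using a by (intro sin_ge_zero) simp_all
    have p: "0 \<le> ?p"
      using y ay by (intro mult_nonneg_nonneg cos_ge_zero) simp_all
    have say: "0 \<le> sin (a * y)"
      using ay by (intro sin_ge_zero) simp_all
    have q: "0 \<le> ?q"
      using y say by (intro mult_nonneg_nonneg[OF sin_ge_zero]) simp_all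
    have "?S\<^sup>2 / a = (?S / a) * ?S"
      by (simp add: power2_eq_square)
    also have "\<dots> \<le> sinh x * ?S"
      using sinh_scaling_le[OF a x] a x by (intro mult_right_mono) (simp_all add: field_simps)
    finally have 1: "?S\<^sup>2 / a * ?p \<le> sinh x * ?S * ?p"
      using p by (rule mult_right_mono)
    have 2: "(1 + ?k * ?S\<^sup>2) * ?q \<le> cosh x * cosh (a * x) * ?q"
      using cosh_product_ge[OF a x] q by (intro mult_right_mono) simp_all
    \<comment> \<open>Coefficient of the square of the hyperbolic sine.\<close>
    have 3: "?S\<^sup>2 * 1 \<le> ?S\<^sup>2 * (?s * (?p / a + ?k * ?q))"
      using weighted_product_ge[OF a y] by (intro mult_left_mono) simp_all
    \<comment> \<open>Constant coefficient.\<close>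
    have 4: "sin (a * y) * sin (a * y) \<le> (sin y * ?s) * sin (a * y)"
      using sin_scaling_le[OF a y] say by (rule mult_right_mono)
    have "?S\<^sup>2 + (sin (a * y))\<^sup>2 \<le> ?S\<^sup>2 * (?s * (?p / a + ?k * ?q)) + ?s * ?q"
      using 3 4 by (simp add: power2_eq_square mult.commute mult.left_commute)
    also have "\<dots> = ?s * (?S\<^sup>2 / a * ?p + (1 + ?k * ?S\<^sup>2) * ?q)"
      by (simp add: distrib_left distrib_right mult_ac)
    also have "\<dots> \<le> ?s * (sinh x * ?S * ?p + cosh x * cosh (a * x) * ?q)"
      using s 1 2 by (intro mult_left_mono add_mono)
    finally show ?thesis .
  qed
  have "sinh \<bar>x\<bar> * sinh (a * \<bar>x\<bar>) = sinh x * sinh (a * x)"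
    and "cosh (a * \<bar>x\<bar>) = cosh (a * x)" and "(sinh (a * \<bar>x\<bar>))\<^sup>2 = (sinh (a * x))\<^sup>2"
    and "sin \<bar>y\<bar> * sin (a * \<bar>y\<bar>) = sin y * sin (a * y)"
    and "cos \<bar>y\<bar> * cos (a * \<bar>y\<bar>) = cos y * cos (a * y)"
    and "(sin (a * \<bar>y\<bar>))\<^sup>2 = (sin (a * y))\<^sup>2"
    by (auto simp: abs_if)
  note parity = this
  show ?thesis
    using *[of "\<bar>x\<bar>" "\<bar>y\<bar>", OF abs_ge_zero abs_ge_zero y]
    by (simp only: parity cosh_real_abs)
qed

lemma Re_sinh: "Re (sinh z) = sinh (Re z) * cos (Im z)"
  by (simp add: sinh_field_def cosh_field_def Re_exp field_simps)

lemma Im_sinh: "Im (sinh z) = cosh (Re z) * sin (Im z)"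
  by (simp add: sinh_field_def cosh_field_def Im_exp field_simps)

lemma Re_sinh_quotient:
  fixes a :: real and z :: complex
  shows "Re (sinh z / sinh (of_real a * z)) =
    (sinh (Re z) * sinh (a * Re z) * (cos (Im z) * cos (a * Im z)) +
     cosh (Re z) * cosh (a * Re z) * (sin (Im z) * sin (a * Im z))) /
    ((sinh (a * Re z))\<^sup>2 + (sin (a * Im z))\<^sup>2)"
proof -
  have "(sinh (a * Re z) * cos (a * Im z))\<^sup>2 + (cosh (a * Re z) * sin (a * Im z))\<^sup>2
    = (sinh (a * Re z))\<^sup>2 + (sin (a * Im z))\<^sup>2"
    by (simp add: cosh_square_eq cos_squared_eq algebra_simps)
  then show ?thesis
    by (simp add: Re_divide Re_sinh Im_sinh mult_ac)
qed

lemma Re_scaled_sinh_quotient_ge: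
  fixes a :: real and z :: complex
  assumes a: "0 < a" "a \<le> 1" and z: "\<bar>Im z\<bar> \<le> pi / 2" "z \<noteq> 0"
  shows "a / sin (pi / 2 * a) \<le> Re (of_real a * sinh z / sinh (of_real a * z))"
proof -
  let ?D = "(sinh (a * Re z))\<^sup>2 + (sin (a * Im z))\<^sup>2"
  have s: "0 < sin (pi / 2 * a)"
    using a by (intro sin_gt_zero) simp_all
  have "?D \<noteq> 0"
  proof
    assume D: "?D = 0"
    then have "Re z = 0" and sy: "sin (a * Im z) = 0"
      using a by (auto)
    moreover have "\<bar>a * Im z\<bar> \<le> pi / 2"
      using a z mult_mono[of a 1 "\<bar>Im z\<bar>" "pi / 2"] by (simp add: abs_mult)
    then have "a * Im z = 0"
      using sy sin_eq_0_pi[of "a * Im z"] pi_gt_zero by linarith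
    ultimately show False
      using a z by (simp add: complex_eq_iff)
  qed
  then have D: "0 < ?D"
    by (simp add: order_less_le)
  have "1 / sin (pi / 2 * a) \<le> Re (sinh z / sinh (of_real a * z))"
    unfolding Re_sinh_quotient
    using sinh_quotient_numerator_ge[OF a z(1), of "Re z"] s D
    by (simp add: field_simps)
  then have "a * (1 / sin (pi / 2 * a)) \<le> a * Re (sinh z / sinh (of_real a * z))"
    using a by (intro mult_left_mono) simp_all
  then have "a / sin (pi / 2 * a) \<le> a * Re (sinh z / sinh (of_real a * z))"
    by simp
  also have "\<dots> = Re (of_real a * sinh z / sinh (of_real a * z))"
    by (simp flip: times_divide_eq_right)
  finally show ?thesis .
qed

section \<open>Lens maps in logarithmic coordinates\<close>

lemma Re_cayley_pos:
  assumes "z \<in> ball 0 1"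
  shows "0 < Re ((1 + z) / (1 - z))"
proof -
  have n: "(Re z)\<^sup>2 + (Im z)\<^sup>2 < 1"
    using assms by (simp add: cmod_def)
  then have "z \<noteq> 1" by auto
  then have "0 < (Re (1 - z))\<^sup>2 + (Im (1 - z))\<^sup>2"
    by (simp add: complex_eq_iff sum_power2_gt_zero_iff)
  moreover have "0 < Re (1 + z) * Re (1 - z) + Im (1 + z) * Im (1 - z)"
    using n by (simp add: power2_eq_square algebra_simps)
  ultimately show ?thesis
    unfolding Re_divide by (rule divide_pos_pos[rotated])
qed

lemma inverse_cayley_in_disc:
  fixes w :: complex
  assumes "0 < Re w"
  shows "(w - 1) / (w + 1) \<in> ball 0 1"
proof -
  have "(cmod (w - 1))\<^sup>2 < (cmod (w + 1))\<^sup>2"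
    using assms unfolding cmod_power2 by (simp add: power2_eq_square algebra_simps)
  then have "cmod (w - 1) < cmod (w + 1)"
    by (rule power_less_imp_less_base) simp
  then show ?thesis
    by (simp add: norm_divide divide_less_eq_1)
qed

text \<open>
  An exponent of modulus at most \<open>1\<close> does not enlarge the argument, so the right half plane is
  preserved. This keeps the denominator of the lens map away from \<open>0\<close>.
\<close>

lemma Re_powr_pos:
  fixes w :: complex and \<alpha> :: real
  assumes w: "0 < Re w" and \<alpha>: "\<bar>\<alpha>\<bar> \<le> 1"
  shows "0 < Re (w powr of_real \<alpha>)"
proof -
  have "\<bar>\<alpha> * Im (Ln w)\<bar> < pi / 2"
    using mult_mono[OF \<alpha> order_refl, of "\<bar>Im (Ln w)\<bar>"] Re_Ln_pos_lt_imp[OF w]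
    by (simp add: abs_mult)
  then have "0 < cos (\<alpha> * Im (Ln w))"
    by (intro cos_gt_zero_pi) linarith+
  then show ?thesis
    using w by (auto simp: powr_def Re_exp)
qed

lemma lens_map_has_field_derivative:
  fixes \<alpha> :: real
  assumes \<alpha>: "\<bar>\<alpha>\<bar> \<le> 1" and z: "z \<in> ball 0 1"
  defines "W \<equiv> ((1 + z) / (1 - z)) powr of_real \<alpha>"
  shows "(lens_map \<alpha> has_field_derivative
    4 * of_real \<alpha> * W / ((1 - z\<^sup>2) * (W + 1)\<^sup>2)) (at z)"
proof -
  let ?w = "(1 + z) / (1 - z)"
  have w: "0 < Re ?w" by (rule Re_cayley_pos[OF z])
  then have w0: "?w \<noteq> 0" "?w \<notin> \<real>\<^sub>\<le>\<^sub>0"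
    by (auto simp: complex_nonpos_Reals_iff)
  have z1: "1 - z \<noteq> 0" "1 + z \<noteq> 0"
    using w0 by auto
  have W1: "W + 1 \<noteq> 0"
    using Re_powr_pos[OF w \<alpha>] unfolding W_def
    by (metis add_eq_0_iff2 add.commute neg_less_0_iff_less not_less_iff_gr_or_eq one_complex.sel(1)
          uminus_complex.sel(1) zero_less_one)
  have "((\<lambda>z. (1 + z) / (1 - z)) has_field_derivative 2 / (1 - z)\<^sup>2) (at z)"
    using z1 by (auto intro!: derivative_eq_intros simp: power2_eq_square field_simps)
  from DERIV_chain2[OF has_field_derivative_powr[OF w0(2)] this]
  have "((\<lambda>z. ((1 + z) / (1 - z)) powr of_real \<alpha>) has_field_derivative
      of_real \<alpha> * ?w powr (of_real \<alpha> - 1) * (2 / (1 - z)\<^sup>2)) (at z)" .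
  also have "?w powr (of_real \<alpha> - 1) = W / ?w"
    using w0 by (simp add: W_def powr_diff)
  also have "of_real \<alpha> * (W / ?w) * (2 / (1 - z)\<^sup>2) = 2 * of_real \<alpha> * W / (1 - z\<^sup>2)"
  proof -
    have "1 - z\<^sup>2 = (1 - z) * (1 + z)" by (simp add: power2_eq_square algebra_simps)
    moreover have "c * (W / (q / p)) * (2 / p\<^sup>2) = 2 * c * W / (p * q)"
      if "p \<noteq> 0" "q \<noteq> 0" for c p q :: complex
      using that by (simp add: power2_eq_square field_simps)
    ultimately show ?thesis using z1 by simp
  qed
  finally have dW: "((\<lambda>z. ((1 + z) / (1 - z)) powr of_real \<alpha>) has_field_derivative
      2 * of_real \<alpha> * W / (1 - z\<^sup>2)) (at z)" .
  have "((\<lambda>u. (u - 1) / (u + 1)) has_field_derivative 2 / (W + 1)\<^sup>2) (at W)"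
    using W1 by (auto intro!: derivative_eq_intros simp: power2_eq_square field_simps)
  from DERIV_chain2[OF this[unfolded W_def] dW]
  show ?thesis
    unfolding lens_map_def[abs_def] W_def by (simp add: mult_ac)
qed

text \<open>
  With \<open>w = exp \<zeta> = (1 + z)/(1 - z)\<close> and \<open>W = exp (\<alpha>\<zeta>)\<close>, the quotient splits into the factors
  \<open>\<alpha>\<close>, \<open>4z/(1 - z\<^sup>2) = w - 1/w = 2 sinh \<zeta>\<close> and \<open>W/(W\<^sup>2 - 1) = 1/(W - 1/W) = 1/(2 sinh (\<alpha>\<zeta>))\<close>.
  Since \<open>sinh\<close> is odd, \<open>\<alpha>\<close> may be replaced by \<open>\<bar>\<alpha>\<bar>\<close>.
\<close>

lemma starlike_quotient_lens_map:
  fixes \<alpha> :: real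
  assumes \<alpha>: "\<alpha> \<noteq> 0" "\<bar>\<alpha>\<bar> \<le> 1" and z: "z \<in> ball 0 1" "z \<noteq> 0"
  defines "\<zeta> \<equiv> Ln ((1 + z) / (1 - z))"
  shows "lens_map \<alpha> z \<noteq> 0"
    and "\<zeta> \<noteq> 0" and "\<bar>Im \<zeta>\<bar> < pi / 2"
    and "starlike_quotient (lens_map \<alpha>) z =
      of_real \<bar>\<alpha>\<bar> * sinh \<zeta> / sinh (of_real \<bar>\<alpha>\<bar> * \<zeta>)"
proof -
  let ?w = "(1 + z) / (1 - z)"
  define W where "W = ?w powr of_real \<alpha>"
  have w: "0 < Re ?w" by (rule Re_cayley_pos[OF z(1)])
  then have w0: "?w \<noteq> 0" by auto
  then have z1: "1 - z \<noteq> 0" "1 + z \<noteq> 0" by auto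
  have expz: "exp \<zeta> = ?w" using w0 by (simp add: \<zeta>_def)
  have expW: "exp (of_real \<alpha> * \<zeta>) = W" using w0 by (auto simp: W_def \<zeta>_def powr_def)
  show im: "\<bar>Im \<zeta>\<bar> < pi / 2"
    unfolding \<zeta>_def by (rule Re_Ln_pos_lt_imp[OF w])
  show \<zeta>0: "\<zeta> \<noteq> 0"
  proof
    assume "\<zeta> = 0"
    then have "?w = 1" using expz by simp
    then show False using z z1 by (simp add: field_simps)
  qed
  have "0 < Re W" unfolding W_def by (rule Re_powr_pos[OF w \<alpha>(2)])
  then have W: "W \<noteq> 0" "W + 1 \<noteq> 0"
    by (auto simp: complex_eq_iff)
  have W1: "W - 1 \<noteq> 0"
  proof
    assume "W - 1 = 0"
    \<comment> \<open>Inside the principal strip, exp attains 1 only at 0.\<close>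
    have "\<bar>\<alpha> * Im \<zeta>\<bar> < pi"
      using mult_mono[OF \<alpha>(2) order_refl, of "\<bar>Im \<zeta>\<bar>"] im by (simp add: abs_mult)
    then have "Ln (exp (of_real \<alpha> * \<zeta>)) = of_real \<alpha> * \<zeta>"
      by (intro Ln_exp) (simp_all add: abs_less_iff)
    then show False
      using \<open>W - 1 = 0\<close> expW \<alpha> \<zeta>0 by simp
  qed
  have lens: "lens_map \<alpha> z = (W - 1) / (W + 1)"
    by (simp add: lens_map_def W_def)
  then show "lens_map \<alpha> z \<noteq> 0" using W W1 by simp
  have "starlike_quotient (lens_map \<alpha>) z
      = z * (4 * of_real \<alpha> * W / ((1 - z\<^sup>2) * (W + 1)\<^sup>2)) / ((W - 1) / (W + 1))"
    using DERIV_imp_deriv[OF lens_map_has_field_derivative[OF \<alpha>(2) z(1)]] z lens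
    by (simp add: starlike_quotient_def W_def)
  also have "\<dots> = of_real \<alpha> * (4 * z / (1 - z\<^sup>2)) * (W / ((W - 1) * (W + 1)))"
  proof -
    have "z * (4 * c * W / (r * p\<^sup>2)) / (q / p) = c * (4 * z / r) * (W / (q * p))"
      if "p \<noteq> 0" "q \<noteq> 0" for c p q r :: complex
      using that by (simp add: power2_eq_square mult_ac)
    then show ?thesis using W(2) W1 by simp
  qed
  also have "4 * z / (1 - z\<^sup>2) = 2 * sinh \<zeta>"
  proof -
    have "1 - z\<^sup>2 = (1 - z) * (1 + z)" by (simp add: power2_eq_square algebra_simps)
    moreover have "2 * sinh \<zeta> = exp \<zeta> - inverse (exp \<zeta>)"
      by (simp add: sinh_field_def exp_minus)
    moreover have "4 * z / (p * q) = q / p - inverse (q / p)"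
      if "p \<noteq> 0" "q \<noteq> 0" "p = 1 - z" "q = 1 + z" for p q
      using that(1,2) by (simp add: field_simps) (simp add: that(3,4) algebra_simps)
    ultimately show ?thesis using z1 expz by metis
  qed
  also have "W / ((W - 1) * (W + 1)) = 1 / (2 * sinh (of_real \<alpha> * \<zeta>))"
  proof -
    have "2 * sinh (of_real \<alpha> * \<zeta>) = W - inverse W"
      by (simp add: sinh_field_def exp_minus expW)
    also have "\<dots> = ((W - 1) * (W + 1)) / W"
      using W by (simp add: field_simps)
    finally show ?thesis by simp
  qed
  finally have "starlike_quotient (lens_map \<alpha>) z
      = of_real \<alpha> * sinh \<zeta> / sinh (of_real \<alpha> * \<zeta>)" by simp
  then show "starlike_quotient (lens_map \<alpha>) z =
      of_real \<bar>\<alpha>\<bar> * sinh \<zeta> / sinh (of_real \<bar>\<alpha>\<bar> * \<zeta>)"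
    by (cases "0 \<le> \<alpha>") simp_all
qed

text \<open>
  These are the points of the imaginary axis with \<open>\<zeta> = it\<close>, along which the infimum is
  approached.
\<close>

lemma starlike_quotient_lens_map_imaginary:
  fixes \<alpha> t :: real
  assumes \<alpha>: "\<alpha> \<noteq> 0" "\<bar>\<alpha>\<bar> \<le> 1" and t: "0 < t" "t < pi / 2"
  defines "z \<equiv> (exp (\<i> * of_real t) - 1) / (exp (\<i> * of_real t) + 1)"
  shows "z \<in> ball 0 1"
    and "Re (starlike_quotient (lens_map \<alpha>) z) = \<bar>\<alpha>\<bar> * sin t / sin (\<bar>\<alpha>\<bar> * t)"
proof -
  let ?w = "exp (\<i> * of_real t)"
  have w: "0 < Re ?w"
    using t by (simp add: Re_exp cos_gt_zero)
  show zb: "z \<in> ball 0 1"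
    unfolding z_def by (rule inverse_cayley_in_disc[OF w])
  have Ln: "Ln ?w = \<i> * of_real t"
    using t by (intro Ln_exp) simp_all
  have w1: "?w + 1 \<noteq> 0"
    using w by (auto simp: complex_eq_iff)
  have "1 + z = 2 * ?w / (?w + 1)" "1 - z = 2 / (?w + 1)"
    using w1 by (simp_all add: z_def field_simps)
  then have zw: "(1 + z) / (1 - z) = ?w"
    using w1 by simp
  have "z \<noteq> 0"
  proof
    assume "z = 0"
    then have "Ln ?w = 0" using zw by simp
    then show False using Ln t by simp
  qed
  from starlike_quotient_lens_map(4)[OF \<alpha> zb this]
  have "Re (starlike_quotient (lens_map \<alpha>) z) =
      \<bar>\<alpha>\<bar> * Re (sinh (\<i> * of_real t) / sinh (of_real \<bar>\<alpha>\<bar> * (\<i> * of_real t)))"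
    unfolding zw Ln by (simp flip: times_divide_eq_right)
  then show "Re (starlike_quotient (lens_map \<alpha>) z) = \<bar>\<alpha>\<bar> * sin t / sin (\<bar>\<alpha>\<bar> * t)"
    unfolding Re_sinh_quotient by (simp add: power2_eq_square)
qed

lemma starlike_quotient_lens_map_ge:
  fixes \<alpha> :: real
  assumes \<alpha>: "\<alpha> \<noteq> 0" "\<bar>\<alpha>\<bar> \<le> 1" and z: "z \<in> ball 0 1"
  shows "\<bar>\<alpha>\<bar> / sin (pi / 2 * \<bar>\<alpha>\<bar>) \<le> Re (starlike_quotient (lens_map \<alpha>) z)"
proof (cases "z = 0")
  case True
  have s: "0 < sin (pi / 2 * \<bar>\<alpha>\<bar>)"
    using \<alpha> by (intro sin_gt_zero) simp_all
  have "\<bar>\<alpha>\<bar> \<le> sin (pi / 2 * \<bar>\<alpha>\<bar>)"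
    using \<alpha> by (intro le_sin_half_pi) simp_all
  then show ?thesis
    using True s by (simp add: starlike_quotient_def)
next
  case False
  show ?thesis
    unfolding starlike_quotient_lens_map(4)[OF \<alpha> z False]
    using starlike_quotient_lens_map(2,3)[OF \<alpha> z False] \<alpha>
    by (intro Re_scaled_sinh_quotient_ge) simp_all
qed

section \<open>Starlikeness of lens maps and its order\<close>

theorem theorem1:
  fixes \<alpha> :: real
  assumes "\<alpha> \<in> {-1..1}" and "\<alpha> \<noteq> 0"
  shows "starlike_map (lens_map \<alpha>) \<and>
         starlikeness_order (lens_map \<alpha>) = \<alpha> / sin (pi / 2 * \<alpha>)"
proof
  let ?f = "lens_map \<alpha>"
  let ?Q = "\<lambda>z. Re (starlike_quotient ?f z)"
  define a where "a = \<bar>\<alpha>\<bar>"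
  have \<alpha>: "\<alpha> \<noteq> 0" "\<bar>\<alpha>\<bar> \<le> 1" and a: "0 < a" "a \<le> 1"
    using assms by (auto simp: a_def)
  have s: "0 < sin (pi / 2 * a)"
    using a by (intro sin_gt_zero) simp_all
  have even: "\<alpha> / sin (pi / 2 * \<alpha>) = a / sin (pi / 2 * a)"
    by (simp add: a_def abs_if)
  have lower: "a / sin (pi / 2 * a) \<le> ?Q z" if "z \<in> ball 0 1" for z
    unfolding a_def by (rule starlike_quotient_lens_map_ge[OF \<alpha> that])
  have hol: "?f holomorphic_on ball 0 1"
    using lens_map_has_field_derivative[OF \<alpha>(2)]
    unfolding holomorphic_on_open[OF open_ball] by blast
  have deriv: "deriv ?f z \<noteq> 0" if z: "z \<in> ball 0 1" for z
  proof -
    define W where "W = ((1 + z) / (1 - z)) powr of_real \<alpha>"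
    have "0 < Re W"
      unfolding W_def by (rule Re_powr_pos[OF Re_cayley_pos[OF z] \<alpha>(2)])
    then have "W \<noteq> 0" "W + 1 \<noteq> 0"
      by (auto simp: complex_eq_iff)
    moreover have "1 - z\<^sup>2 \<noteq> 0"
      using z by (auto simp: power2_eq_1_iff)
    ultimately show ?thesis
      using DERIV_imp_deriv[OF lens_map_has_field_derivative[OF \<alpha>(2) z]] \<alpha>
      by (simp add: W_def)
  qed
  have "\<exists>U. open U \<and> z \<in> U \<and> U \<subseteq> ball 0 1 \<and> inj_on ?f U" if "z \<in> ball 0 1" for z
    using has_complex_derivative_locally_injective[OF hol that open_ball deriv[OF that]]
    by (metis centre_in_ball open_ball)
  then show "starlike_map ?f"
    unfolding starlike_map_def locally_univalent_on_def
    using hol starlike_quotient_lens_map(1)[OF \<alpha>] lower less_le_trans[OF divide_pos_pos[OF a(1) s]]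
    by (auto simp: lens_map_def)
  have "starlikeness_order ?f \<le> a * sin t / sin (a * t)" if "t \<in> {0<..<pi / 2}" for t
  proof -
    \<comment> \<open>The point of the disc with logarithmic coordinate it.\<close>
    let ?z = "(exp (\<i> * of_real t) - 1) / (exp (\<i> * of_real t) + 1)"
    have "?z \<in> ball 0 1" and "?Q ?z = a * sin t / sin (a * t)"
      using starlike_quotient_lens_map_imaginary[OF \<alpha>, of t] that by (simp_all add: a_def)
    moreover have "bdd_below (?Q ` ball 0 1)"
      using lower by (rule bdd_belowI2)
    ultimately show ?thesis
      unfolding starlikeness_order_def by (metis cINF_lower)
  qed
  then have ev: "\<forall>\<^sub>F t in at_left (pi / 2). starlikeness_order ?f \<le> a * sin t / sin (a * t)"
    by (rule eventually_at_leftI[of 0]) simp_all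
  have lim: "((\<lambda>t. a * sin t / sin (a * t)) \<longlongrightarrow>
      a * sin (pi / 2) / sin (a * (pi / 2))) (at_left (pi / 2))"
    using s by (intro tendsto_intros) (simp add: mult.commute)
  have upper: "starlikeness_order ?f \<le> a * sin (pi / 2) / sin (a * (pi / 2))"
    by (rule tendsto_lowerbound[OF lim ev trivial_limit_at_left_real])
  have "a / sin (pi / 2 * a) \<le> starlikeness_order ?f"
    unfolding starlikeness_order_def using lower by (intro cINF_greatest) simp_all
  with upper show "starlikeness_order ?f = \<alpha> / sin (pi / 2 * \<alpha>)"
    unfolding even by (simp add: mult.commute)
qed

end
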